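(* The Cesàro operator $C$ on $L^2(0,1)$, $(Cf)(x)=\frac1x\int_0^x\frac{f(t)}{1-t}\,dt$ for $0<x<1$, is cyclic with cyclic vector $\chi_{[0,1]}$ (the constant function $1$); that is, the closed linear span of $\{C^n\chi_{[0,1]}:n\ge 0\}$ is all of $L^2(0,1)$.
   Context: $L^2(0,1)$ is the Hilbert space of complex-valued square-integrable functions on $(0,1)$ with respect to Lebesgue measure; $C$ is a bounded linear operator on it. A bounded operator $T$ on a separable Hilbert space $\mathcal{H}$ is cyclic with cyclic vector $\mathbf{x}\in\mathcal H$ if the closed linear span of $\{T^n\mathbf{x}:n\ge0\}$ equals $\mathcal{H}$. *)

theory Defs
  imports "HOL-Analysis.Analysis"
begin

text \<open>
  The norm and topology of a complex inner product space are those of the underlying real inner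
  product \<open>Re (cinner x y)\<close>, so \<open>norm x = sqrt (Re (cinner x x))\<close>; \<open>cinner\<close> is linear in its
  first argument.
\<close>

class complex_inner = real_inner +
  fixes scaleC :: "complex \<Rightarrow> 'a \<Rightarrow> 'a" (infixr \<open>*\<^sub>C\<close> 75)
    and cinner :: "'a \<Rightarrow> 'a \<Rightarrow> complex"
  assumes scaleC_add_right: "a *\<^sub>C (x + y) = a *\<^sub>C x + a *\<^sub>C y"
    and scaleC_add_left: "(a + b) *\<^sub>C x = a *\<^sub>C x + b *\<^sub>C x"
    and scaleC_scaleC: "a *\<^sub>C b *\<^sub>C x = (a * b) *\<^sub>C x"
    and scaleC_one: "1 *\<^sub>C x = x"
    and scaleR_scaleC: "r *\<^sub>R x = complex_of_real r *\<^sub>C x"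
    and cinner_commute: "cinner x y = cnj (cinner y x)"
    and cinner_add_left: "cinner (x + y) z = cinner x z + cinner y z"
    and cinner_scaleC_left: "cinner (a *\<^sub>C x) y = a * cinner x y"
    and inner_eq_Re_cinner: "inner x y = Re (cinner x y)"

global_interpretation complex_vector: vector_space "scaleC :: complex \<Rightarrow> 'a \<Rightarrow> 'a :: complex_inner"
  by standard (simp_all add: scaleC_add_right scaleC_add_left scaleC_scaleC scaleC_one)

definition bounded_clinear :: "('a::complex_inner \<Rightarrow> 'b::complex_inner) \<Rightarrow> bool" where
  "bounded_clinear T \<longleftrightarrow> bounded_linear T \<and> (\<forall>c x. T (c *\<^sub>C x) = c *\<^sub>C T x)"

text \<open>
  Linear spans are over the complex numbers. Separability of the space is not required here, as it
  follows from the existence of a cyclic vector.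
\<close>

definition cyclic_vector :: "('a::complex_inner \<Rightarrow> 'a) \<Rightarrow> 'a \<Rightarrow> bool" where
  "cyclic_vector T x \<longleftrightarrow>
     bounded_clinear T \<and> closure (complex_vector.span (range (\<lambda>n. (T ^^ n) x))) = UNIV"

abbreviation I01 :: "real measure" where
  "I01 \<equiv> lebesgue_on {0<..<1}"

definition square_integrable :: "(real \<Rightarrow> complex) \<Rightarrow> bool" where
  "square_integrable f \<longleftrightarrow> f \<in> borel_measurable I01 \<and> integrable I01 (\<lambda>x. (cmod (f x))\<^sup>2)"

definition L2_rel :: "(real \<Rightarrow> complex) \<Rightarrow> (real \<Rightarrow> complex) \<Rightarrow> bool" where
  "L2_rel f g \<longleftrightarrow> square_integrable f \<and> square_integrable g \<and> (AE x in I01. f x = g x)"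

lemma square_integrable_measurable [measurable_dest]:
  "square_integrable f \<Longrightarrow> f \<in> borel_measurable I01"
  by (simp add: square_integrable_def)

lemma finite_measure_I01: "finite_measure I01"
  by (rule finite_measure_lebesgue_on) simp

lemma ident_I01 [measurable]: "(\<lambda>x. x) \<in> borel_measurable I01"
  by (intro measurable_restrict_space1 measurable_completion) simp

lemma square_integrable_const: "square_integrable (\<lambda>x. c)"
  using finite_measure.integrable_const[OF finite_measure_I01]
  by (simp add: square_integrable_def)

quotient_type L2 = "real \<Rightarrow> complex" / partial: L2_rel
proof (rule part_equivpI)
  show "\<exists>f. L2_rel f f"
    using square_integrable_const[of 0] by (auto simp: L2_rel_def)
  show "symp L2_rel"
    by (auto simp: symp_def L2_rel_def)
  show "transp L2_rel"
    unfolding transp_def L2_rel_def by (auto elim: AE_mp)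
qed

lemma square_integrable_add:
  assumes "square_integrable f" "square_integrable g"
  shows "square_integrable (\<lambda>x. f x + g x)"
proof -
  note [measurable] = assms[THEN square_integrable_measurable]
  have "integrable I01 (\<lambda>x. (cmod (f x + g x))\<^sup>2)"
  proof (rule Bochner_Integration.integrable_bound)
    show "integrable I01 (\<lambda>x. 2 * (cmod (f x))\<^sup>2 + 2 * (cmod (g x))\<^sup>2)"
      using assms by (simp add: square_integrable_def)
    have "(cmod (f x + g x))\<^sup>2 \<le> 2 * (cmod (f x))\<^sup>2 + 2 * (cmod (g x))\<^sup>2" for x
    proof -
      have "(cmod (f x + g x))\<^sup>2 \<le> (cmod (f x) + cmod (g x))\<^sup>2"
        by (intro power_mono norm_triangle_ineq norm_ge_zero)
      also have "\<dots> \<le> 2 * (cmod (f x))\<^sup>2 + 2 * (cmod (g x))\<^sup>2"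
        using sum_squares_bound[of "cmod (f x)" "cmod (g x)"] by (simp add: power2_sum)
      finally show ?thesis .
    qed
    then show "AE x in I01. norm ((cmod (f x + g x))\<^sup>2) \<le> norm (2 * (cmod (f x))\<^sup>2 + 2 * (cmod (g x))\<^sup>2)"
      by (intro AE_I2) simp
  qed measurable
  then show ?thesis
    by (simp add: square_integrable_def)
qed

lemma square_integrable_scale:
  "square_integrable f \<Longrightarrow> square_integrable (\<lambda>x. c * f x)"
  by (auto simp: square_integrable_def norm_mult power_mult_distrib intro!: borel_measurable_times)

lemma square_integrable_uminus: "square_integrable f \<Longrightarrow> square_integrable (\<lambda>x. - f x)"
  using square_integrable_scale[of f "-1"] by simp

lemma square_integrable_diff:
  "square_integrable f \<Longrightarrow> square_integrable g \<Longrightarrow> square_integrable (\<lambda>x. f x - g x)"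
  using square_integrable_add[of f "\<lambda>x. - g x"] square_integrable_uminus[of g] by simp

lemma mult_le_sum_squares:
  fixes a b :: real
  assumes "0 \<le> a" "0 \<le> b"
  shows "a * b \<le> a\<^sup>2 + b\<^sup>2"
  using sum_squares_bound[of a b] mult_nonneg_nonneg[OF assms] unfolding mult.assoc by linarith

lemma integrable_mult_cnj:
  assumes "square_integrable f" "square_integrable g"
  shows "integrable I01 (\<lambda>x. f x * cnj (g x))"
proof (rule Bochner_Integration.integrable_bound)
  note [measurable] = assms[THEN square_integrable_measurable]
  show "integrable I01 (\<lambda>x. (cmod (f x))\<^sup>2 + (cmod (g x))\<^sup>2)"
    using assms by (simp add: square_integrable_def)
  have [measurable]: "cnj \<in> borel_measurable borel"
    by (intro borel_measurable_continuous_onI continuous_intros)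
  show "(\<lambda>x. f x * cnj (g x)) \<in> borel_measurable I01"
    by measurable
  have "cmod (f x) * cmod (g x) \<le> (cmod (f x))\<^sup>2 + (cmod (g x))\<^sup>2" for x
    by (rule mult_le_sum_squares) simp_all
  then show "AE x in I01. norm (f x * cnj (g x)) \<le> norm ((cmod (f x))\<^sup>2 + (cmod (g x))\<^sup>2)"
    by (intro AE_I2) (simp add: norm_mult)
qed

instantiation L2 :: complex_inner
begin

lift_definition zero_L2 :: L2 is "\<lambda>x. 0"
  using square_integrable_const by (auto simp: L2_rel_def)

lift_definition plus_L2 :: "L2 \<Rightarrow> L2 \<Rightarrow> L2" is "\<lambda>f g x. f x + g x"
  by (auto simp: L2_rel_def intro: square_integrable_add)

lift_definition uminus_L2 :: "L2 \<Rightarrow> L2" is "\<lambda>f x. - f x"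
  by (auto simp: L2_rel_def intro: square_integrable_uminus)

lift_definition minus_L2 :: "L2 \<Rightarrow> L2 \<Rightarrow> L2" is "\<lambda>f g x. f x - g x"
  by (auto simp: L2_rel_def intro: square_integrable_diff)

lift_definition scaleC_L2 :: "complex \<Rightarrow> L2 \<Rightarrow> L2" is "\<lambda>c f x. c * f x"
  by (auto simp: L2_rel_def intro: square_integrable_scale)

definition scaleR_L2 :: "real \<Rightarrow> L2 \<Rightarrow> L2" where
  "scaleR_L2 r f = complex_of_real r *\<^sub>C f"

lift_definition cinner_L2 :: "L2 \<Rightarrow> L2 \<Rightarrow> complex" is "\<lambda>f g. LINT x|I01. f x * cnj (g x)"
proof -
  fix f f' g g' assume *: "L2_rel f f'" "L2_rel g g'"
  then have "square_integrable f" "square_integrable g" "square_integrable f'" "square_integrable g'"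
    by (auto simp: L2_rel_def)
  then show "(LINT x|I01. f x * cnj (g x)) = (LINT x|I01. f' x * cnj (g' x))"
    using * integrable_mult_cnj
    by (intro integral_cong_AE) (auto simp: L2_rel_def dest: borel_measurable_integrable)
qed

definition inner_L2 :: "L2 \<Rightarrow> L2 \<Rightarrow> real" where
  "inner_L2 f g = Re (cinner f g)"

definition norm_L2 :: "L2 \<Rightarrow> real" where
  "norm_L2 f = sqrt (inner f f)"

definition sgn_L2 :: "L2 \<Rightarrow> L2" where
  "sgn_L2 f = inverse (norm f) *\<^sub>R f"

definition dist_L2 :: "L2 \<Rightarrow> L2 \<Rightarrow> real" where
  "dist_L2 f g = norm (f - g)"

definition uniformity_L2 :: "(L2 \<times> L2) filter" where
  "uniformity_L2 = (INF e\<in>{0<..}. principal {(f, g). dist f g < e})"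

definition open_L2 :: "L2 set \<Rightarrow> bool" where
  "open_L2 U \<longleftrightarrow> (\<forall>f\<in>U. eventually (\<lambda>(f', g). f' = f \<longrightarrow> g \<in> U) uniformity)"

instance
proof
  fix f g h :: L2 and a b :: complex and r s :: real
  show "f + g + h = f + (g + h)" "f + g = g + f" "0 + f = f" "- f + f = 0" "f - g = f + - g"
    by (transfer; auto simp: L2_rel_def square_integrable_const algebra_simps
        intro!: square_integrable_add square_integrable_diff square_integrable_uminus)+
  show C: "a *\<^sub>C (f + g) = a *\<^sub>C f + a *\<^sub>C g" "(a + b) *\<^sub>C f = a *\<^sub>C f + b *\<^sub>C f"
    "a *\<^sub>C b *\<^sub>C f = (a * b) *\<^sub>C f" "1 *\<^sub>C f = f" for f g :: L2 and a b
    by (transfer; auto simp: L2_rel_def algebra_simps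
        intro!: square_integrable_add square_integrable_scale
        square_integrable_scale[where c="_ * _", simplified mult.assoc])+
  show "r *\<^sub>R f = complex_of_real r *\<^sub>C f"
    by (simp add: scaleR_L2_def)
  show "r *\<^sub>R (f + g) = r *\<^sub>R f + r *\<^sub>R g" "(r + s) *\<^sub>R f = r *\<^sub>R f + s *\<^sub>R f"
    "r *\<^sub>R s *\<^sub>R f = (r * s) *\<^sub>R f" "1 *\<^sub>R f = f"
    by (simp_all add: scaleR_L2_def C)
  show cinner_commute: "cinner f g = cnj (cinner g f)" for f g :: L2
    by transfer (subst Bochner_Integration.integral_cnj[symmetric], simp add: mult.commute)
  show add: "cinner (f + g) h = cinner f h + cinner g h"
    by transfer (simp add: L2_rel_def distrib_right integrable_mult_cnj)
  show scale: "cinner (a *\<^sub>C f) g = a * cinner f g" for a and f g :: L2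
    by transfer (simp add: mult.assoc)
  show "inner f g = Re (cinner f g)"
    by (simp add: inner_L2_def)
  show "inner f g = inner g f"
    by (metis cinner_commute cnj.simps(1) inner_L2_def)
  show "inner (f + g) h = inner f h + inner g h"
    by (simp add: inner_L2_def add)
  show "inner (r *\<^sub>R f) g = r * inner f g"
    by (simp add: inner_L2_def scaleR_L2_def scale)
  have Re: "Re (LINT x|I01. F x * cnj (F x)) = (LINT x|I01. (cmod (F x))\<^sup>2)" for F
    by (simp add: complex_norm_square[symmetric] del: of_real_power)
  show "0 \<le> inner f f"
    unfolding inner_L2_def by transfer (simp add: Re)
  show "inner f f = 0 \<longleftrightarrow> f = 0"
    unfolding inner_L2_def
    by transfer (auto simp: Re L2_rel_def square_integrable_const square_integrable_def
        integral_nonneg_eq_0_iff_AE)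
  show "norm f = sqrt (inner f f)" by (rule norm_L2_def)
  show "sgn f = inverse (norm f) *\<^sub>R f" by (rule sgn_L2_def)
  show "dist f g = norm (f - g)" by (rule dist_L2_def)
  show "(uniformity :: (L2 \<times> L2) filter) = (INF e\<in>{0<..}. principal {(f, g). dist f g < e})"
    by (rule uniformity_L2_def)
  show "open U \<longleftrightarrow> (\<forall>f\<in>U. eventually (\<lambda>(f', g). f' = f \<longrightarrow> g \<in> U) uniformity)" for U :: "L2 set"
    by (rule open_L2_def)
qed

end

lift_definition one_L2 :: L2 is "\<lambda>x. 1"
  using square_integrable_const by (auto simp: L2_rel_def)


text \<open>
  The integral is taken over \<open>lebesgue\<close> and not \<open>lborel\<close>: representatives of elements of L2 are only
  Lebesgue measurable.
\<close>

definition cesaro_fun :: "(real \<Rightarrow> complex) \<Rightarrow> real \<Rightarrow> complex" where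
  "cesaro_fun f x = complex_of_real (1 / x) * (LINT t:{0<..<x}|lebesgue. f t / complex_of_real (1 - t))"

text \<open>Boundedness on L2(0,1) is the Schur test for the kernel \<open>k\<close> with weight \<open>w\<close>.\<close>

context
  fixes k :: "real \<Rightarrow> real \<Rightarrow> real" and w :: "real \<Rightarrow> real"
  defines "k \<equiv> \<lambda>x t. if t < x then 1 / (x * (1 - t)) else 0"
    and "w \<equiv> \<lambda>t. 1 / sqrt (t * (1 - t))"
begin

lemma nn_integral_I01_FTC:
  fixes F g :: "real \<Rightarrow> real"
  assumes ab: "0 \<le> a" "a \<le> b" "b \<le> 1"
    and cont: "continuous_on {a..b} F"
    and deriv: "\<And>x. a < x \<Longrightarrow> x < b \<Longrightarrow> (F has_real_derivative g x) (at x)"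
    and nonneg: "\<And>x. a < x \<Longrightarrow> x < b \<Longrightarrow> 0 \<le> g x"
    and zero: "\<And>x. 0 < x \<Longrightarrow> x < 1 \<Longrightarrow> x \<notin> {a<..<b} \<Longrightarrow> g x = 0"
  shows "(\<integral>\<^sup>+x. ennreal (g x) \<partial>I01) = ennreal (F b - F a)"
proof -
  have "(g has_integral F b - F a) {a..b}"
    using deriv ab cont
    by (intro fundamental_theorem_of_calculus_interior)
       (auto simp: has_real_derivative_iff_has_vector_derivative)
  then have int: "(g has_integral F b - F a) {a<..<b}"
    by (simp add: has_integral_Icc_iff_Ioo)
  have "(\<integral>\<^sup>+x. ennreal (g x) \<partial>I01) = (\<integral>\<^sup>+x. ennreal (g x) * indicator {0<..<1} x \<partial>lborel)"
    by (simp add: nn_integral_restrict_space nn_integral_completion)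
  also have "\<dots> = (\<integral>\<^sup>+x. ennreal (indicator {a<..<b} x * g x) \<partial>lborel)"
    using ab zero by (intro nn_integral_cong) (auto simp: indicator_def)
  also have "\<dots> = ennreal (F b - F a)"
    using nonneg int nn_integral_has_integral_lebesgue[of "{a<..<b}" g] by (auto simp: mult.commute)
  finally show ?thesis .
qed

lemma schur_row:
  assumes "0 < x" "x < 1"
  shows "(\<integral>\<^sup>+t. ennreal (k x t * w t) \<partial>I01) = ennreal (2 * w x)"
proof -
  define F where "F t = 2 / x * sqrt (t / (1 - t))" for t
  have "(\<integral>\<^sup>+t. ennreal (k x t * w t) \<partial>I01) = ennreal (F x - F 0)"
  proof (rule nn_integral_I01_FTC[where F = F and a = 0 and b = x])
    show "continuous_on {0..x} F"
      unfolding F_def using assms by (intro continuous_intros) auto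
    fix t assume t: "0 < t" "t < x"
    have "((\<lambda>t. t / (1 - t)) has_real_derivative 1 / (1 - t)\<^sup>2) (at t)"
      using t assms by (auto intro!: derivative_eq_intros simp: power2_eq_square divide_simps)
    moreover have "0 < t / (1 - t)" using t assms by simp
    ultimately have deriv: "(F has_real_derivative 2 / x * (1 / (1 - t)\<^sup>2 * (inverse (sqrt (t / (1 - t))) / 2))) (at t)"
      unfolding F_def by (intro DERIV_cmult DERIV_chain'[OF _ DERIV_real_sqrt, simplified mult.commute])
    have "sqrt (t / (1 - t)) * (1 - t) = sqrt (t * (1 - t))"
      using t assms real_sqrt_mult[of "t / (1 - t)" "(1 - t)\<^sup>2"] by (simp add: power2_eq_square)
    then have eq: "1 / (1 - t)\<^sup>2 * inverse (sqrt (t / (1 - t))) = 1 / (1 - t) * w t"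
      using t assms by (simp add: w_def power2_eq_square divide_simps) (simp add: mult.commute)
    have scale: "2 / x * (a * (b / 2)) = 1 / x * (a * b)" for a b :: real
      by simp
    have "1 / x * (1 / (1 - t) * w t) = k x t * w t"
      using t by (simp add: k_def)
    then show "(F has_real_derivative k x t * w t) (at t)"
      using deriv unfolding scale eq by (simp only:)
    show "0 \<le> k x t * w t"
      using t assms by (simp add: k_def w_def)
  qed (use assms in \<open>auto simp: k_def\<close>)
  also have "F x - F 0 = 2 * w x"
    using assms by (simp add: F_def w_def real_sqrt_divide real_sqrt_mult divide_simps)
  finally show ?thesis .
qed

lemma schur_column:
  assumes "0 < t" "t < 1"
  shows "(\<integral>\<^sup>+x. ennreal (k x t * w x) \<partial>I01) = ennreal (2 * w t)"
proof -
  define F where "F x = - 2 / (1 - t) * sqrt ((1 - x) / x)" for x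
  have "(\<integral>\<^sup>+x. ennreal (k x t * w x) \<partial>I01) = ennreal (F 1 - F t)"
  proof (rule nn_integral_I01_FTC[where F = F and a = t and b = 1])
    show "continuous_on {t..1} F"
      unfolding F_def using assms by (intro continuous_intros) auto
    fix x assume x: "t < x" "x < 1"
    have "((\<lambda>x. (1 - x) / x) has_real_derivative - 1 / x\<^sup>2) (at x)"
      using x assms by (auto intro!: derivative_eq_intros simp: power2_eq_square divide_simps)
    moreover have "0 < (1 - x) / x" using x assms by simp
    ultimately have deriv: "(F has_real_derivative - 2 / (1 - t) * (- 1 / x\<^sup>2 * (inverse (sqrt ((1 - x) / x)) / 2))) (at x)"
      unfolding F_def by (intro DERIV_cmult DERIV_chain'[OF _ DERIV_real_sqrt, simplified mult.commute])
    have "sqrt ((1 - x) / x) * x = sqrt (x * (1 - x))"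
      using x assms real_sqrt_mult[of "(1 - x) / x" "x\<^sup>2"] by (simp add: power2_eq_square mult.commute)
    then have eq: "1 / x\<^sup>2 * inverse (sqrt ((1 - x) / x)) = 1 / x * w x"
      using x assms by (simp add: w_def power2_eq_square divide_simps) (simp add: mult.commute)
    have scale: "- 2 / (1 - t) * (- 1 / a * (b / 2)) = 1 / (1 - t) * (1 / a * b)" for a b :: real
      by simp
    have "1 / (1 - t) * (1 / x * w x) = k x t * w x"
      using x by (simp add: k_def)
    then show "(F has_real_derivative k x t * w x) (at x)"
      using deriv unfolding scale eq by (simp only:)
    show "0 \<le> k x t * w x"
      using x assms by (simp add: k_def w_def)
  qed (use assms in \<open>auto simp: k_def\<close>)
  also have "F 1 - F t = 2 * w t"
    using assms by (simp add: F_def w_def real_sqrt_divide real_sqrt_mult divide_simps)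
  finally show ?thesis .
qed

lemma k_measurable [measurable]: "case_prod k \<in> borel_measurable (I01 \<Otimes>\<^sub>M I01)"
proof -
  have [measurable]: "fst \<in> borel_measurable (I01 \<Otimes>\<^sub>M I01)" "snd \<in> borel_measurable (I01 \<Otimes>\<^sub>M I01)"
    using measurable_compose[OF measurable_fst ident_I01] measurable_compose[OF measurable_snd ident_I01]
    by auto
  show ?thesis
    unfolding k_def case_prod_beta by measurable
qed

lemma w_measurable [measurable]: "w \<in> borel_measurable I01"
  unfolding w_def by measurable

lemma cesaro_fun_eq:
  assumes "0 < x" "x < 1"
  shows "cesaro_fun f x = (LINT t|I01. complex_of_real (k x t) * f t)"
proof -
  have "cesaro_fun f x = (LINT t|lebesgue. complex_of_real (1 / x) * (indicator {0<..<x} t *\<^sub>R (f t / complex_of_real (1 - t))))"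
    unfolding cesaro_fun_def set_lebesgue_integral_def by (rule integral_mult_right_zero[symmetric])
  also have "\<dots> = (LINT t|lebesgue. indicator {0<..<1} t *\<^sub>R (complex_of_real (k x t) * f t))"
    using assms by (intro Bochner_Integration.integral_cong) (auto simp: k_def indicator_def)
  also have "\<dots> = (LINT t|I01. complex_of_real (k x t) * f t)"
    by (simp add: integral_restrict_space)
  finally show ?thesis .
qed

lemma cesaro_fun_measurable:
  assumes [measurable]: "f \<in> borel_measurable I01"
  shows "cesaro_fun f \<in> borel_measurable I01"
proof -
  interpret finite_measure I01 by (rule finite_measure_I01)
  have "(\<lambda>x. LINT t|I01. complex_of_real (k x t) * f t) \<in> borel_measurable I01"
    by measurable
  then show ?thesis
    by (rule measurable_cong[THEN iffD1, rotated]) (auto simp: cesaro_fun_eq)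
qed

lemma cesaro_fun_bound:
  assumes [measurable]: "f \<in> borel_measurable I01"
  shows "(\<integral>\<^sup>+x. ennreal ((cmod (cesaro_fun f x))\<^sup>2) \<partial>I01) \<le> 4 * (\<integral>\<^sup>+x. ennreal ((cmod (f x))\<^sup>2) \<partial>I01)"
proof -
  interpret finite_measure I01 by (rule finite_measure_I01)
  interpret P: pair_sigma_finite I01 I01 ..
  have k_nonneg: "0 \<le> k x t" if "0 < x" "t < 1" for x t
    using that by (simp add: k_def)
  have w_pos: "0 < w t" if "0 < t" "t < 1" for t
    using that by (simp add: w_def)
  have pointwise: "ennreal ((cmod (cesaro_fun f x))\<^sup>2) \<le>
      (\<integral>\<^sup>+t. ennreal (2 * w x * (k x t * ((cmod (f t))\<^sup>2 / w t))) \<partial>I01)" if x: "0 < x" "x < 1" for x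
  proof -
    have kx [measurable]: "k x \<in> borel_measurable I01"
      unfolding k_def by measurable
    have "ennreal (cmod (cesaro_fun f x)) \<le> (\<integral>\<^sup>+t. ennreal (cmod (complex_of_real (k x t) * f t)) \<partial>I01)"
      unfolding cesaro_fun_eq[OF x]
      using integral_norm_bound_ennreal[of I01 "\<lambda>t. complex_of_real (k x t) * f t"]
        not_integrable_integral_eq[of I01 "\<lambda>t. complex_of_real (k x t) * f t"]
      by (cases "integrable I01 (\<lambda>t. complex_of_real (k x t) * f t)") auto
    also have "\<dots> = (\<integral>\<^sup>+t. ennreal (sqrt (k x t * w t)) * ennreal (sqrt (k x t / w t) * cmod (f t)) \<partial>I01)"
    proof (rule nn_integral_cong)
      fix t assume "t \<in> space I01"
      then have t: "0 < t" "t < 1" by auto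
      have "sqrt (k x t * w t) * sqrt (k x t / w t) = k x t"
        using k_nonneg[OF x(1) t(2)] w_pos[OF t] by (simp flip: real_sqrt_mult)
      then show "ennreal (cmod (complex_of_real (k x t) * f t)) =
          ennreal (sqrt (k x t * w t)) * ennreal (sqrt (k x t / w t) * cmod (f t))"
        using k_nonneg[OF x(1) t(2)] w_pos[OF t]
        by (simp add: norm_mult mult.assoc[symmetric] flip: ennreal_mult)
    qed
    finally have "(ennreal (cmod (cesaro_fun f x)))\<^sup>2 \<le>
      (\<integral>\<^sup>+t. ennreal (sqrt (k x t * w t)) * ennreal (sqrt (k x t / w t) * cmod (f t)) \<partial>I01)\<^sup>2"
      by (rule power_mono) simp
    also have "\<dots> \<le> (\<integral>\<^sup>+t. (ennreal (sqrt (k x t * w t)))\<^sup>2 \<partial>I01) *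
        (\<integral>\<^sup>+t. (ennreal (sqrt (k x t / w t) * cmod (f t)))\<^sup>2 \<partial>I01)"
      by (intro Cauchy_Schwarz_nn_integral) measurable
    also have "(\<integral>\<^sup>+t. (ennreal (sqrt (k x t * w t)))\<^sup>2 \<partial>I01) = (\<integral>\<^sup>+t. ennreal (k x t * w t) \<partial>I01)"
      using k_nonneg[OF x(1)] w_pos
      by (intro nn_integral_cong) (auto simp: ennreal_power less_imp_le)
    also have "\<dots> = ennreal (2 * w x)"
      by (rule schur_row[OF x])
    also have "(\<integral>\<^sup>+t. (ennreal (sqrt (k x t / w t) * cmod (f t)))\<^sup>2 \<partial>I01) =
        (\<integral>\<^sup>+t. ennreal (k x t * ((cmod (f t))\<^sup>2 / w t)) \<partial>I01)"
      using k_nonneg[OF x(1)] w_pos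
      by (intro nn_integral_cong) (auto simp: ennreal_power power_mult_distrib less_imp_le)
    also have "ennreal (2 * w x) * \<dots> = (\<integral>\<^sup>+t. ennreal (2 * w x) * ennreal (k x t * ((cmod (f t))\<^sup>2 / w t)) \<partial>I01)"
      by (rule nn_integral_cmult[symmetric]) measurable
    also have "\<dots> = (\<integral>\<^sup>+t. ennreal (2 * w x * (k x t * ((cmod (f t))\<^sup>2 / w t))) \<partial>I01)"
      using k_nonneg[OF x(1)] w_pos[OF x] w_pos
      by (intro nn_integral_cong) (auto simp: less_imp_le simp flip: ennreal_mult)
    finally show ?thesis
      by (simp add: ennreal_power)
  qed
  have "(\<integral>\<^sup>+x. ennreal ((cmod (cesaro_fun f x))\<^sup>2) \<partial>I01) \<le>
      (\<integral>\<^sup>+x. (\<integral>\<^sup>+t. ennreal (2 * w x * (k x t * ((cmod (f t))\<^sup>2 / w t))) \<partial>I01) \<partial>I01)"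
    using pointwise by (intro nn_integral_mono) auto
  also have "\<dots> = (\<integral>\<^sup>+t. (\<integral>\<^sup>+x. ennreal (2 * w x * (k x t * ((cmod (f t))\<^sup>2 / w t))) \<partial>I01) \<partial>I01)"
    by (rule P.Fubini') measurable
  also have "\<dots> = (\<integral>\<^sup>+t. ennreal (4 * (cmod (f t))\<^sup>2) \<partial>I01)"
  proof (rule nn_integral_cong)
    fix t assume "t \<in> space I01"
    then have t: "0 < t" "t < 1" by auto
    have [measurable]: "(\<lambda>x. k x t) \<in> borel_measurable I01"
      unfolding k_def by measurable
    have "(\<integral>\<^sup>+x. ennreal (2 * w x * (k x t * ((cmod (f t))\<^sup>2 / w t))) \<partial>I01) =
        (\<integral>\<^sup>+x. ennreal (2 * ((cmod (f t))\<^sup>2 / w t)) * ennreal (k x t * w x) \<partial>I01)"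
      using k_nonneg[OF _ t(2)] w_pos[OF t] w_pos
      by (intro nn_integral_cong) (auto simp: less_imp_le ac_simps simp flip: ennreal_mult)
    also have "\<dots> = ennreal (2 * ((cmod (f t))\<^sup>2 / w t)) * ennreal (2 * w t)"
      by (subst nn_integral_cmult) (use schur_column[OF t] in auto)
    also have "\<dots> = ennreal (4 * (cmod (f t))\<^sup>2)"
      using w_pos[OF t] by (simp flip: ennreal_mult)
    finally show "(\<integral>\<^sup>+x. ennreal (2 * w x * (k x t * ((cmod (f t))\<^sup>2 / w t))) \<partial>I01) = ennreal (4 * (cmod (f t))\<^sup>2)" .
  qed
  also have "\<dots> = 4 * (\<integral>\<^sup>+x. ennreal ((cmod (f x))\<^sup>2) \<partial>I01)"
    by (simp add: ennreal_mult nn_integral_cmult)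
  finally show ?thesis .
qed

lemma integrable_kernel_mult:
  assumes f: "square_integrable f" and x: "0 < x" "x < 1"
  shows "integrable I01 (\<lambda>t. complex_of_real (k x t) * f t)"
proof (rule Bochner_Integration.integrable_bound)
  note [measurable] = square_integrable_measurable[OF f]
  have [measurable]: "k x \<in> borel_measurable I01"
    unfolding k_def by measurable
  show "(\<lambda>t. complex_of_real (k x t) * f t) \<in> borel_measurable I01"
    by (intro borel_measurable_times borel_measurable_of_real) measurable
  have bound: "\<bar>k x t\<bar> \<le> 1 / (x * (1 - x))" if "t < 1" for t
    using that x by (auto simp: k_def abs_mult intro!: divide_left_mono mult_left_mono)
  have "integrable I01 (\<lambda>t. k x t ^ 2)"
    using x bound
    by (intro finite_measure.integrable_const_bound[OF finite_measure_I01, of _ "(1 / (x * (1 - x)))\<^sup>2"] AE_I2)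
       (auto simp: abs_le_square_iff[symmetric] simp del: power_divide)
  then show "integrable I01 (\<lambda>t. k x t ^ 2 + (cmod (f t))\<^sup>2)"
    using f by (simp add: square_integrable_def)
  have "\<bar>k x t\<bar> * cmod (f t) \<le> k x t ^ 2 + (cmod (f t))\<^sup>2" for t
    using mult_le_sum_squares[of "\<bar>k x t\<bar>" "cmod (f t)"] by simp
  then show "AE t in I01. norm (complex_of_real (k x t) * f t) \<le> norm (k x t ^ 2 + (cmod (f t))\<^sup>2)"
    by (intro AE_I2) (simp add: norm_mult)
qed

lemma cesaro_fun_add:
  assumes "square_integrable f" "square_integrable g" "0 < x" "x < 1"
  shows "cesaro_fun (\<lambda>t. f t + g t) x = cesaro_fun f x + cesaro_fun g x"
  using assms by (simp add: cesaro_fun_eq distrib_left integrable_kernel_mult)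

lemma cesaro_fun_scale:
  assumes "0 < x" "x < 1"
  shows "cesaro_fun (\<lambda>t. c * f t) x = c * cesaro_fun f x"
  using assms by (simp add: cesaro_fun_eq mult.left_commute[of _ c])

lemma cesaro_fun_cong:
  assumes "square_integrable f" "square_integrable g" "AE t in I01. f t = g t" "0 < x" "x < 1"
  shows "cesaro_fun f x = cesaro_fun g x"
proof -
  have "(\<lambda>t. complex_of_real (k x t) * h t) \<in> borel_measurable I01" if "square_integrable h" for h
    using integrable_kernel_mult[OF that assms(4,5)] by (rule borel_measurable_integrable)
  then show ?thesis
    unfolding cesaro_fun_eq[OF assms(4,5)]
    using assms(1-3) by (intro integral_cong_AE) auto
qed

end

lemma square_integrable_cesaro_fun:
  assumes f: "square_integrable f"
  shows "square_integrable (cesaro_fun f)"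
proof -
  note [measurable] = square_integrable_measurable[OF f] cesaro_fun_measurable[OF square_integrable_measurable[OF f]]
  have "(\<integral>\<^sup>+x. ennreal ((cmod (f x))\<^sup>2) \<partial>I01) < \<infinity>"
    using f by (simp add: square_integrable_def integrable_iff_bounded)
  then have "4 * (\<integral>\<^sup>+x. ennreal ((cmod (f x))\<^sup>2) \<partial>I01) < \<infinity>"
    by (simp add: ennreal_mult_less_top)
  with cesaro_fun_bound[OF square_integrable_measurable[OF f]]
  have "(\<integral>\<^sup>+x. ennreal ((cmod (cesaro_fun f x))\<^sup>2) \<partial>I01) < \<infinity>"
    by (rule order_le_less_trans)
  then show ?thesis
    by (simp add: square_integrable_def integrable_iff_bounded)
qed

lift_definition cesaro :: "L2 \<Rightarrow> L2" is cesaro_fun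
proof -
  fix f g assume "L2_rel f g"
  then have fg: "square_integrable f" "square_integrable g" "AE x in I01. f x = g x"
    by (auto simp: L2_rel_def)
  then have "AE x in I01. cesaro_fun f x = cesaro_fun g x"
    by (auto intro!: AE_I2 cesaro_fun_cong[OF fg])
  with fg show "L2_rel (cesaro_fun f) (cesaro_fun g)"
    by (simp add: L2_rel_def square_integrable_cesaro_fun)
qed

lemma norm_L2_sq: "square_integrable f \<Longrightarrow> (norm (abs_L2 f))\<^sup>2 = (LINT x|I01. (cmod (f x))\<^sup>2)"
  by (simp add: norm_eq_sqrt_inner inner_L2_def cinner_L2.abs_eq L2_rel_def
      complex_norm_square[symmetric] del: of_real_power)

lemma norm_cesaro_le: "norm (cesaro f) \<le> 2 * norm f"
proof (induction f rule: L2.abs_induct)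
  case (1 f)
  then have f: "square_integrable f" by (simp add: L2_rel_def)
  note C = square_integrable_cesaro_fun[OF f]
  have "ennreal (LINT x|I01. (cmod (cesaro_fun f x))\<^sup>2) \<le> 4 * ennreal (LINT x|I01. (cmod (f x))\<^sup>2)"
    using cesaro_fun_bound[OF square_integrable_measurable[OF f]] f C
    by (simp add: nn_integral_eq_integral square_integrable_def)
  then have "ennreal ((norm (cesaro (abs_L2 f)))\<^sup>2) \<le> ennreal (4 * (norm (abs_L2 f))\<^sup>2)"
    using f by (simp add: cesaro.abs_eq L2_rel_def norm_L2_sq C ennreal_mult)
  then have "(norm (cesaro (abs_L2 f)))\<^sup>2 \<le> (2 * norm (abs_L2 f))\<^sup>2"
    by (simp add: power_mult_distrib)
  then show ?case
    by (rule power2_le_imp_le) simp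
qed

lemma bounded_clinear_cesaro: "bounded_clinear cesaro"
proof -
  have add: "cesaro (f + g) = cesaro f + cesaro g" for f g
    by transfer (auto simp: L2_rel_def cesaro_fun_add
        intro!: AE_I2 square_integrable_cesaro_fun square_integrable_add)
  have scale: "cesaro (c *\<^sub>C f) = c *\<^sub>C cesaro f" for c f
    by transfer (auto simp: L2_rel_def cesaro_fun_scale
        intro!: AE_I2 square_integrable_cesaro_fun square_integrable_scale)
  have "bounded_linear cesaro"
  proof (rule bounded_linear_intro[where K = 2])
    show "norm (cesaro f) \<le> norm f * 2" for f
      using norm_cesaro_le[of f] by simp
  qed (simp_all only: add scaleR_scaleC scale)
  with scale show ?thesis
    by (simp add: bounded_clinear_def)
qed

end

theory Submission
  imports Defs
begin

text \<open>
  Let \<open>C\<close> be the Cesaro operator and \<open>M\<close> the closed span of the orbit of \<open>1\<close> under \<open>C\<close>. The product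
  rule \<open>(t\<^sup>n\<^sup>+\<^sup>1)' = (n + 1) t\<^sup>n\<close> says that \<open>C e\<^sub>n = x\<^sup>n\<close> for \<open>e\<^sub>n = (n + 1) (x\<^sup>n - x\<^sup>n\<^sup>+\<^sup>1)\<close>. So if \<open>M\<close> could be
  divided by \<open>C\<close>, meaning that \<open>C f \<in> M\<close> implies \<open>f \<in> M\<close>, then \<open>x\<^sup>n \<in> M\<close> would give \<open>e\<^sub>n \<in> M\<close> and hence
  \<open>x\<^sup>n\<^sup>+\<^sup>1 \<in> M\<close>. Starting from \<open>1 \<in> M\<close>, all monomials would lie in \<open>M\<close>, and polynomials are dense in
  \<open>L\<^sup>2(0,1)\<close> (lemma \<open>monomials_total\<close>).

  Division by \<open>C\<close> is possible because \<open>U = I - C\<close> is an isometry (\<open>norm_diff_cesaro\<close>). If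
  \<open>C f = f - U f\<close> lies in \<open>M\<close>, then so does \<open>f - U\<^sup>j f\<close> for every \<open>j\<close>, and so does the difference
  between \<open>f\<close> and the average of \<open>f, U f, \<dots>, U\<^sup>N\<^sup>-\<^sup>1 f\<close>. As in the mean ergodic theorem, these averages
  tend to \<open>0\<close>: on the range of \<open>C = I - U\<close> they telescope, and this range is dense because it contains
  the monomials. Therefore \<open>f \<in> M\<close> (\<open>mem_closed_subspace_if_defect_mem\<close>).

  The isometry property amounts to \<open>\<langle>C f, C g\<rangle> = \<langle>C f, g\<rangle> + \<langle>f, C g\<rangle>\<close>. On the functions \<open>e\<^sub>n\<close>, whose
  linear span is dense, it is an identity between the numbers
  \<open>\<langle>x\<^sup>m, x\<^sup>n\<rangle> = 1 / (m + n + 1)\<close>, and it extends by continuity.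
\<close>

section \<open>Closed subspaces invariant under a contraction\<close>

lemma closure_subspace_real:
  fixes S :: "'a::real_normed_vector set"
  assumes S: "subspace S"
  shows "subspace (closure S)"
proof (rule subspaceI)
  show "0 \<in> closure S"
    using closure_subset subspace_0[OF S] by blast
next
  fix x y assume "x \<in> closure S" "y \<in> closure S"
  then obtain u v where "\<And>n. u n \<in> S" "u \<longlonglongrightarrow> x" "\<And>n. v n \<in> S" "v \<longlonglongrightarrow> y"
    unfolding closure_sequential by blast
  then show "x + y \<in> closure S"
    unfolding closure_sequential
    by (intro exI[of _ "\<lambda>n. u n + v n"]) (auto intro: tendsto_add subspace_add[OF S])
next
  fix c x assume "x \<in> closure S"
  then obtain u where "\<And>n. u n \<in> S" "u \<longlonglongrightarrow> x"
    unfolding closure_sequential by blast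
  then show "c *\<^sub>R x \<in> closure S"
    unfolding closure_sequential
    by (intro exI[of _ "\<lambda>n. c *\<^sub>R u n"]) (auto intro: tendsto_scaleR subspace_scale[OF S])
qed

lemma subspace_if_complex_subspace:
  assumes "complex_vector.subspace S"
  shows "subspace S"
  using assms unfolding subspace_def complex_vector.subspace_def scaleR_scaleC by blast

text \<open>
  The averages \<open>A f\<close> of \<open>f, U f, \<dots>, U\<^sup>N\<^sup>-\<^sup>1 f\<close> tend to \<open>0\<close>, since they do so on the dense range of \<open>I - U\<close>
  and are contractions. On the other hand \<open>f - A f\<close> stays in \<open>M\<close>, so \<open>f\<close> is a limit of elements
  of \<open>M\<close>.
\<close>

lemma mem_closed_subspace_if_defect_mem:
  fixes U :: "'a::real_normed_vector \<Rightarrow> 'a"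
  assumes U: "linear U" and contr: "\<And>x. norm (U x) \<le> norm x"
    and dense: "closure (range (\<lambda>x. x - U x)) = UNIV"
    and M: "subspace M" "closed M" and inv: "\<And>x. x \<in> M \<Longrightarrow> U x \<in> M"
    and f: "f - U f \<in> M"
  shows "f \<in> M"
proof -
  have lin: "linear (U ^^ n)" for n
  proof (induction n)
    case 0
    show ?case by (simp add: linear_ident)
  next
    case (Suc n)
    show ?case using linear_compose[OF Suc U] by (simp add: o_def)
  qed
  have norm_pow: "norm ((U ^^ n) x) \<le> norm x" for n x
    by (induction n) (auto intro: order_trans[OF contr])
  have diff_mem: "f - (U ^^ n) f \<in> M" for n
  proof (induction n)
    case 0
    then show ?case using subspace_0[OF M(1)] by simp
  next
    case (Suc n)
    have "f - (U ^^ Suc n) f = (f - U f) + U (f - (U ^^ n) f)"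
      using linear_diff[OF U] by simp
    then show ?case
      using subspace_add[OF M(1) f inv[OF Suc]] by (simp only:)
  qed
  have "f \<in> closure M"
    unfolding closure_approachable
  proof (intro allI impI)
    fix e :: real assume e: "0 < e"
    \<comment> \<open>One half of \<open>e\<close> is spent on replacing \<open>f\<close> by \<open>g - U g\<close>, the other half on the telescoped
      average of \<open>g - U g\<close>, whose norm is at most \<open>2 * norm g / N\<close>.\<close>
    obtain g where g: "norm ((g - U g) - f) < e / 2"
    proof -
      have "f \<in> closure (range (\<lambda>x. x - U x))" using dense by simp
      then obtain y where "y \<in> range (\<lambda>x. x - U x)" "norm (y - f) < e / 2"
        using half_gt_zero[OF e] unfolding closure_approachable dist_norm by blast
      then show ?thesis using that by auto
    qed
    obtain N where N: "4 * norm g / e < real N"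
      using reals_Archimedean2 by blast
    then have N0: "0 < N"
      using e by (metis divide_nonneg_pos gr0I mult_nonneg_nonneg norm_ge_zero not_less of_nat_0 zero_le_numeral)
    define A where "A x = (1 / real N) *\<^sub>R (\<Sum>j<N. (U ^^ j) x)" for x
    have A_diff: "A (x - y) = A x - A y" for x y
      unfolding A_def by (simp add: linear_diff[OF lin] sum_subtractf scaleR_diff_right)
    have A_le: "norm (A x) \<le> norm x" for x
    proof -
      have "norm (\<Sum>j<N. (U ^^ j) x) \<le> (\<Sum>j<N. norm x)"
        by (intro sum_norm_le norm_pow)
      then show ?thesis
        using N0 by (simp add: A_def field_simps)
    qed
    have "A (g - U g) = (1 / real N) *\<^sub>R (\<Sum>j<N. (U ^^ j) g - (U ^^ Suc j) g)"
      unfolding A_def by (simp add: linear_diff[OF lin] funpow_swap1)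
    also have "\<dots> = (1 / real N) *\<^sub>R (g - (U ^^ N) g)"
      by (subst sum_lessThan_telescope') simp
    finally have "norm (A (g - U g)) = norm (g - (U ^^ N) g) / real N"
      by simp
    also have "\<dots> \<le> (2 * norm g) / real N"
      using norm_triangle_ineq4[of g "(U ^^ N) g"] norm_pow[of N g] by (intro divide_right_mono) auto
    also have "\<dots> < e / 2"
      using N e N0 by (simp add: field_simps)
    finally have "norm (A (g - U g)) < e / 2" .
    moreover have "norm (A ((g - U g) - f)) < e / 2"
      using A_le g by (rule order_le_less_trans)
    moreover have "A f = A (g - U g) - A ((g - U g) - f)"
      by (simp add: A_diff)
    ultimately have "norm (A f) < e"
      using norm_triangle_ineq4[of "A (g - U g)" "A ((g - U g) - f)"] by simp
    moreover have "f - A f = (1 / real N) *\<^sub>R (\<Sum>j<N. f - (U ^^ j) f)"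
      using N0 by (simp add: A_def sum_subtractf scaleR_diff_right sum_constant_scaleR)
    then have "f - A f \<in> M"
      using diff_mem by (auto intro: subspace_scale subspace_sum M)
    ultimately show "\<exists>y\<in>M. dist y f < e"
      by (intro bexI[of _ "f - A f"]) (auto simp: dist_norm)
  qed
  then show ?thesis using M(2) by simp
qed

section \<open>Density of the polynomials\<close>

lemma square_integrable_bounded:
  assumes [measurable]: "f \<in> borel_measurable I01"
    and B: "\<And>x. x \<in> {0<..<1} \<Longrightarrow> cmod (f x) \<le> B"
  shows "square_integrable f"
proof -
  have "integrable I01 (\<lambda>x. (cmod (f x))\<^sup>2)"
  proof (rule finite_measure.integrable_const_bound[OF finite_measure_I01, of _ "B\<^sup>2"])
    show "AE x in I01. norm ((cmod (f x))\<^sup>2) \<le> B\<^sup>2"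
      using power_mono[OF B norm_ge_zero, of _ 2] by (intro AE_I2) simp
  qed measurable
  then show ?thesis by (simp add: square_integrable_def)
qed

lemma abs_L2_diff:
  "square_integrable f \<Longrightarrow> square_integrable g \<Longrightarrow> abs_L2 f - abs_L2 g = abs_L2 (\<lambda>x. f x - g x)"
  by (simp add: minus_L2.abs_eq L2_rel_def)

lemma abs_L2_add:
  "square_integrable f \<Longrightarrow> square_integrable g \<Longrightarrow> abs_L2 f + abs_L2 g = abs_L2 (\<lambda>x. f x + g x)"
  by (simp add: plus_L2.abs_eq L2_rel_def)

lemma abs_L2_scale:
  "square_integrable f \<Longrightarrow> c *\<^sub>C abs_L2 f = abs_L2 (\<lambda>x. c * f x)"
  by (simp add: scaleC_L2.abs_eq L2_rel_def)

lemma abs_L2_eqI: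
  "square_integrable f \<Longrightarrow> square_integrable g \<Longrightarrow> (\<And>x. x \<in> {0<..<1} \<Longrightarrow> f x = g x) \<Longrightarrow> abs_L2 f = abs_L2 g"
  by (intro Quotient_rel_abs[OF Quotient_L2]) (auto simp: L2_rel_def intro: AE_I2)

text \<open>Dominated convergence for \<open>L\<^sup>2\<close> norms: \<open>(2 * w)\<^sup>2\<close> dominates the squared distance to the limit.\<close>

lemma abs_L2_tendsto:
  assumes f: "\<And>n. square_integrable (f n)" and g: "square_integrable g"
    and w: "integrable I01 (\<lambda>x. (w x)\<^sup>2)"
    and bound: "\<And>n. AE x in I01. cmod (f n x) \<le> w x"
    and lim: "AE x in I01. (\<lambda>n. f n x) \<longlonglongrightarrow> g x"
  shows "(\<lambda>n. abs_L2 (f n)) \<longlonglongrightarrow> abs_L2 g"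
proof -
  note [measurable] = f[THEN square_integrable_measurable] g[THEN square_integrable_measurable]
  have all_bound: "AE x in I01. \<forall>n. cmod (f n x) \<le> w x"
    using bound by (simp add: AE_all_countable)
  then have g_bound: "AE x in I01. cmod (g x) \<le> w x"
    using lim
  proof eventually_elim
    case (elim x)
    then show ?case
      by (intro Lim_bounded[where M=0, OF tendsto_norm[OF elim(2)]]) auto
  qed
  have "(\<lambda>n. LINT x|I01. (cmod (f n x - g x))\<^sup>2) \<longlonglongrightarrow> (LINT x|I01. 0)"
  proof (rule integral_dominated_convergence)
    show "integrable I01 (\<lambda>x. 4 * (w x)\<^sup>2)"
      using w by simp
    show "AE x in I01. (\<lambda>n. (cmod (f n x - g x))\<^sup>2) \<longlonglongrightarrow> 0"
      using lim
    proof eventually_elim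
      case (elim x)
      then have "(\<lambda>n. f n x - g x) \<longlonglongrightarrow> 0" by (simp add: LIM_zero)
      then show ?case using tendsto_power[OF tendsto_norm, of _ 0 _ 2] by force
    qed
    show "AE x in I01. norm ((cmod (f n x - g x))\<^sup>2) \<le> 4 * (w x)\<^sup>2" for n
      using bound[of n] g_bound
    proof eventually_elim
      case (elim x)
      then have "cmod (f n x - g x) \<le> 2 * w x"
        using norm_triangle_ineq4[of "f n x" "g x"] by linarith
      then have "(cmod (f n x - g x))\<^sup>2 \<le> (2 * w x)\<^sup>2"
        by (intro power_mono) auto
      then show ?case by (simp add: power_mult_distrib)
    qed
  qed measurable
  then have "(\<lambda>n. (norm (abs_L2 (f n) - abs_L2 g))\<^sup>2) \<longlonglongrightarrow> 0"
    using f g by (simp add: abs_L2_diff norm_L2_sq square_integrable_diff)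
  then have "(\<lambda>n. sqrt ((norm (abs_L2 (f n) - abs_L2 g))\<^sup>2)) \<longlonglongrightarrow> sqrt 0"
    by (rule tendsto_real_sqrt)
  then show ?thesis
    by (simp add: LIM_zero_iff tendsto_norm_zero_iff)
qed

lemma continuous_imp_borel_measurable_I01:
  assumes "continuous_on {0..1} f"
  shows "f \<in> borel_measurable I01"
  using assms by (intro continuous_imp_measurable_on_sets_lebesgue)
    (auto intro: continuous_on_subset)

lemma continuous_imp_square_integrable:
  assumes "continuous_on {0..1} f"
  shows "square_integrable f"
proof -
  have "bounded (f ` {0..1})"
    using assms by (intro compact_imp_bounded compact_continuous_image) auto
  then obtain B where "\<And>x. x \<in> {0..1} \<Longrightarrow> cmod (f x) \<le> B"
    unfolding bounded_iff by blast
  then show ?thesis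
    by (intro square_integrable_bounded[of _ B] continuous_imp_borel_measurable_I01 assms) auto
qed

definition monomial :: "nat \<Rightarrow> L2" where
  "monomial n = abs_L2 (\<lambda>x. complex_of_real (x ^ n))"

lemma square_integrable_power: "square_integrable (\<lambda>x. complex_of_real (x ^ n))"
  by (intro continuous_imp_square_integrable continuous_intros)

lemma square_integrable_diff_power:
  "square_integrable (\<lambda>x. complex_of_real (x ^ m) - complex_of_real (x ^ n))"
  by (intro square_integrable_diff square_integrable_power)

lemma polynomial_mem:
  assumes K: "subspace K" and mon: "\<And>c n. c *\<^sub>C monomial n \<in> K"
  shows "abs_L2 (\<lambda>x. \<Sum>i\<le>n. a i * complex_of_real (x ^ i)) \<in> K"
proof -
  have "square_integrable (\<lambda>x. \<Sum>i\<le>n. a i * complex_of_real (x ^ i))" for n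
    by (intro continuous_imp_square_integrable continuous_intros)
  then have "abs_L2 (\<lambda>x. \<Sum>i\<le>n. a i * complex_of_real (x ^ i)) = (\<Sum>i\<le>n. a i *\<^sub>C monomial i)"
    by (induction n)
      (simp_all add: monomial_def abs_L2_scale square_integrable_power square_integrable_scale
        abs_L2_add[symmetric] square_integrable_const del: of_real_power power_Suc)
  then show ?thesis
    using K mon by (simp add: subspace_sum)
qed

text \<open>
  This joins the Stone-Weierstrass theorem, whose vector-valued polynomials are defined through their
  real components, to combinations of monomials with complex coefficients.
\<close>

lemma complex_polynomial_function_sum:
  fixes g :: "real \<Rightarrow> complex"
  assumes "polynomial_function g"
  obtains a n where "g = (\<lambda>x. \<Sum>i\<le>n. a i * complex_of_real (x ^ i))"
proof -
  have "real_polynomial_function (Re \<circ> g)" "real_polynomial_function (Im \<circ> g)"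
    using assms bounded_linear_Re bounded_linear_Im unfolding polynomial_function_def by blast+
  then obtain a m b n where a: "Re \<circ> g = (\<lambda>x. \<Sum>i\<le>m. a i * x ^ i)" and b: "Im \<circ> g = (\<lambda>x. \<Sum>i\<le>n. b i * x ^ i)"
    unfolding real_polynomial_function_iff_sum by blast
  define c where "c i = Complex (if i \<le> m then a i else 0) (if i \<le> n then b i else 0)" for i
  have "g x = (\<Sum>i\<le>max m n. c i * complex_of_real (x ^ i))" for x
  proof (rule complex_eqI)
    have "Re (g x) = (\<Sum>i\<le>m. a i * x ^ i)"
      using fun_cong[OF a, of x] by simp
    also have "\<dots> = (\<Sum>i\<le>max m n. (if i \<le> m then a i else 0) * x ^ i)"
      by (intro sum.mono_neutral_cong_left) auto
    finally show "Re (g x) = Re (\<Sum>i\<le>max m n. c i * complex_of_real (x ^ i))"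
      by (simp add: c_def Re_sum del: of_real_power)
    have "Im (g x) = (\<Sum>i\<le>n. b i * x ^ i)"
      using fun_cong[OF b, of x] by simp
    also have "\<dots> = (\<Sum>i\<le>max m n. (if i \<le> n then b i else 0) * x ^ i)"
      by (intro sum.mono_neutral_cong_left) auto
    finally show "Im (g x) = Im (\<Sum>i\<le>max m n. c i * complex_of_real (x ^ i))"
      by (simp add: c_def Im_sum del: of_real_power)
  qed
  then show ?thesis using that[of c "max m n"] by blast
qed

text \<open>
  Density is stated as an induction principle: a closed real subspace that contains all complex
  multiples of the monomials is everything. The subspace grows by limits: Stone-Weierstrass gives the
  continuous functions, almost everywhere approximation by continuous functions gives the bounded
  measurable ones, and truncation of large values gives the rest.
\<close>

lemma monomials_total:
  assumes K: "subspace K" "closed K" and mon: "\<And>c n. c *\<^sub>C monomial n \<in> K"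
  shows "K = UNIV"
proof -
  have limit: "abs_L2 g \<in> K"
    if "\<And>n. square_integrable (f n)" "square_integrable g" "integrable I01 (\<lambda>x. (w x)\<^sup>2)"
      "\<And>n. AE x in I01. cmod (f n x) \<le> w x" "AE x in I01. (\<lambda>n. f n x) \<longlonglongrightarrow> g x"
      "\<And>n. abs_L2 (f n) \<in> K" for f g and w :: "real \<Rightarrow> real"
    using closed_sequentially[OF K(2) that(6) abs_L2_tendsto[OF that(1-5)]] .
  have const: "integrable I01 (\<lambda>x. (B::real)\<^sup>2)" for B
    using finite_measure.integrable_const[OF finite_measure_I01] .
  have continuous: "abs_L2 f \<in> K" if f: "continuous_on {0..1} f" for f
  proof -
    have "\<exists>p. polynomial_function p \<and> (\<forall>x\<in>{0..1}. cmod (f x - p x) < inverse (real (Suc n)))" for n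
      by (rule Stone_Weierstrass_polynomial_function[OF compact_Icc f]) simp
    then obtain p where p: "\<And>n. polynomial_function (p n)"
      and close: "\<And>n x. x \<in> {0..1} \<Longrightarrow> cmod (f x - p n x) < inverse (real (Suc n))"
      by metis
    have "bounded (f ` {0..1})"
      using f by (intro compact_imp_bounded compact_continuous_image) auto
    then obtain B where B: "\<And>x. x \<in> {0..1} \<Longrightarrow> cmod (f x) \<le> B"
      unfolding bounded_iff by blast
    show ?thesis
    proof (rule limit[where f = p and w = "\<lambda>_. B + 1"])
      show "square_integrable f"
        by (rule continuous_imp_square_integrable[OF f])
      show "square_integrable (p n)" for n
        by (intro continuous_imp_square_integrable continuous_on_polymonial_function p)
      show "AE x in I01. cmod (p n x) \<le> B + 1" for n
      proof (rule AE_I2)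
        fix x assume "x \<in> space I01"
        then have x: "x \<in> {0..1}" by auto
        have "inverse (real (Suc n)) \<le> 1" by (simp add: field_simps)
        then show "cmod (p n x) \<le> B + 1"
          using B[OF x] close[OF x, of n] norm_triangle_sub[of "p n x" "f x"]
          by (simp add: norm_minus_commute)
      qed
      show "AE x in I01. (\<lambda>n. p n x) \<longlonglongrightarrow> f x"
      proof (rule AE_I2)
        fix x assume "x \<in> space I01"
        then have x: "x \<in> {0..1}" by auto
        have "(\<lambda>n. p n x - f x) \<longlonglongrightarrow> 0"
          by (rule Lim_null_comparison[OF _ LIMSEQ_inverse_real_of_nat])
            (use close[OF x] in \<open>auto simp: norm_minus_commute intro!: always_eventually less_imp_le\<close>)
        then show "(\<lambda>n. p n x) \<longlonglongrightarrow> f x"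
          by (simp add: LIM_zero_iff)
      qed
      show "abs_L2 (p n) \<in> K" for n
        using complex_polynomial_function_sum[OF p] polynomial_mem[OF K(1) mon] by metis
    qed (rule const)
  qed
  have bounded: "abs_L2 f \<in> K"
    if f: "f \<in> borel_measurable I01" and B: "\<And>x. cmod (f x) \<le> B" for f B
  proof -
    have B0: "0 \<le> B" using order_trans[OF norm_ge_zero B[of 0]] .
    have "f measurable_on {0<..<1}"
      using f by (simp add: measurable_on_iff_borel_measurable)
    then obtain N g where N: "negligible N" and g: "\<And>n. continuous_on UNIV (g n)"
      and lim: "\<And>x. x \<notin> N \<Longrightarrow> (\<lambda>n. g n x) \<longlonglongrightarrow> (if x \<in> {0<..<1} then f x else 0)"
      unfolding measurable_on_def by blast
    \<comment> \<open>Almost everywhere convergent approximants may be unbounded. Projecting their values to the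
      disc of radius \<open>B\<close> keeps them continuous, leaves \<open>f\<close> unchanged and supplies a dominating
      constant.\<close>
    let ?clip = "closest_point (cball (0::complex) B)"
    have clip: "continuous_on UNIV ?clip"
      using B0 by (intro continuous_on_closest_point) auto
    have clip_le: "cmod (?clip z) \<le> B" for z
      using closest_point_in_set[of "cball (0::complex) B" z] B0 by auto
    have cont: "continuous_on {0..1} (\<lambda>x. ?clip (g n x))" for n
      by (rule continuous_on_compose2[OF clip continuous_on_subset[OF g]]) auto
    show ?thesis
    proof (rule limit[where f = "\<lambda>n x. ?clip (g n x)" and w = "\<lambda>_. B"])
      show "square_integrable (\<lambda>x. ?clip (g n x))" for n
        by (rule continuous_imp_square_integrable[OF cont])
      show "square_integrable f"
        by (rule square_integrable_bounded[OF f B])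
      show "AE x in I01. cmod (?clip (g n x)) \<le> B" for n
        using clip_le by simp
      have "AE x in lebesgue. x \<notin> N"
        using N by (auto simp: negligible_iff_null_sets intro: AE_not_in)
      then have "AE x in I01. x \<notin> N"
        by (subst AE_restrict_space_iff) auto
      then show "AE x in I01. (\<lambda>n. ?clip (g n x)) \<longlonglongrightarrow> f x"
        using AE_space
      proof eventually_elim
        case (elim x)
        then have "(\<lambda>n. g n x) \<longlonglongrightarrow> f x" using lim[of x] by simp
        then have "(\<lambda>n. ?clip (g n x)) \<longlonglongrightarrow> ?clip (f x)"
          by (intro continuous_on_tendsto_compose[OF clip]) auto
        then show ?case using B[of x] by (simp add: closest_point_self)
      qed
      show "abs_L2 (\<lambda>x. ?clip (g n x)) \<in> K" for n
        by (rule continuous[OF cont])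
    qed (rule const)
  qed
  have "abs_L2 f \<in> K" if f: "square_integrable f" for f
  proof -
    note [measurable] = square_integrable_measurable[OF f]
    define h where "h n x = (if cmod (f x) \<le> real n then f x else 0)" for n x
    have h: "h n \<in> borel_measurable I01" for n
      unfolding h_def by measurable
    have h_le: "cmod (h n x) \<le> real n" for n x by (simp add: h_def)
    show ?thesis
    proof (rule limit[where f = h and w = "\<lambda>x. cmod (f x)"])
      show "square_integrable (h n)" for n
        by (rule square_integrable_bounded[OF h h_le])
      show "integrable I01 (\<lambda>x. (cmod (f x))\<^sup>2)"
        using f by (simp add: square_integrable_def)
      show "AE x in I01. (\<lambda>n. h n x) \<longlonglongrightarrow> f x"
      proof (rule AE_I2)
        fix x
        obtain N where "cmod (f x) \<le> real N" using real_arch_simple by blast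
        then have "eventually (\<lambda>n. h n x = f x) sequentially"
          unfolding eventually_sequentially h_def by (intro exI[of _ N]) auto
        then show "(\<lambda>n. h n x) \<longlonglongrightarrow> f x" by (rule tendsto_eventually)
      qed
      show "abs_L2 (h n) \<in> K" for n
        by (rule bounded[OF h h_le])
    qed (auto simp: f h_def)
  qed
  then have "x \<in> K" for x
    by (induction x rule: L2.abs_induct) (simp add: L2_rel_def)
  then show ?thesis by blast
qed

section \<open>The Cesaro operator on a dense set\<close>

lemma cinner_monomial: "cinner (monomial m) (monomial n) = complex_of_real (1 / real (m + n + 1))"
proof -
  have "((\<lambda>x::real. x ^ k) has_integral (1 ^ Suc k / real (Suc k) - 0 ^ Suc k / real (Suc k))) {0..1}" for k
    by (intro fundamental_theorem_of_calculus)
      (auto intro!: derivative_eq_intros simp: has_real_derivative_iff_has_vector_derivative[symmetric]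
        simp del: of_nat_Suc power_Suc)
  from this[of "m + n"] have "((\<lambda>x::real. x ^ (m + n)) has_integral (1 / real (m + n + 1))) {0<..<1}"
    by (simp add: has_integral_Icc_iff_Ioo)
  then have int: "integral {0<..<1} (\<lambda>x::real. x ^ (m + n)) = 1 / real (m + n + 1)"
    by (rule integral_unique)
  have "cinner (monomial m) (monomial n) = (LINT x|I01. complex_of_real (x ^ m) * cnj (complex_of_real (x ^ n)))"
    unfolding monomial_def by (rule cinner_L2.abs_eq)
      (simp_all add: L2_rel_def square_integrable_power del: of_real_power)
  also have "\<dots> = complex_of_real (LINT x|I01. x ^ (m + n))"
    by (simp add: power_add flip: of_real_mult of_real_power)
  also have "(LINT x|I01. x ^ (m + n)) = integral {0<..<1} (\<lambda>x. x ^ (m + n))"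
  proof (rule lebesgue_integral_eq_integral)
    show "integrable I01 (\<lambda>x. x ^ (m + n))"
      by (rule finite_measure.integrable_const_bound[OF finite_measure_I01, of _ 1])
        (auto intro!: AE_I2 power_le_one borel_measurable_power)
  qed simp
  finally show ?thesis unfolding int .
qed

text \<open>
  As a function, \<open>(n + 1) * x ^ n * (1 - x)\<close>: the factor \<open>1 - x\<close> cancels the weight in the Cesaro
  integral, and \<open>n + 1\<close> cancels the factor from integrating \<open>x ^ n\<close>.
\<close>

definition cesaro_preimage :: "nat \<Rightarrow> L2" where
  "cesaro_preimage n = real (n + 1) *\<^sub>R (monomial n - monomial (n + 1))"

lemma cesaro_cesaro_preimage: "cesaro (cesaro_preimage n) = monomial n"
proof -
  let ?f = "\<lambda>x. complex_of_real (real (n + 1)) * (complex_of_real (x ^ n) - complex_of_real (x ^ (n + 1)))"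
  have f: "square_integrable ?f"
    by (intro square_integrable_scale square_integrable_diff_power)
  have "cesaro_preimage n = abs_L2 ?f"
    unfolding cesaro_preimage_def monomial_def scaleR_scaleC
    by (simp only: abs_L2_diff abs_L2_scale square_integrable_power square_integrable_diff_power)
  moreover have "cesaro_fun ?f x = complex_of_real (x ^ n)" if x: "x \<in> {0<..<1}" for x
  proof -
    have "((\<lambda>t. complex_of_real (real (n + 1) * t ^ n)) has_integral
        (complex_of_real (x ^ (n + 1)) - complex_of_real (0 ^ (n + 1)))) {0..x}"
    proof (intro fundamental_theorem_of_calculus has_vector_derivative_of_real)
      show "((\<lambda>t. t ^ (n + 1)) has_real_derivative real (n + 1) * t ^ n) (at t within {0..x})" for t
        by (rule derivative_eq_intros refl | simp)+
    qed (use x in auto)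
    then have int: "integral {0<..<x} (\<lambda>t. complex_of_real (real (n + 1) * t ^ n)) = complex_of_real (x ^ (n + 1))"
      unfolding has_integral_Icc_iff_Ioo by (intro integral_unique) simp
    have "(LINT t:{0<..<x}|lebesgue. ?f t / complex_of_real (1 - t)) =
        (LINT t:{0<..<x}|lebesgue. complex_of_real (real (n + 1) * t ^ n))"
    proof (rule set_lebesgue_integral_cong)
      show "\<forall>t. t \<in> {0<..<x} \<longrightarrow> ?f t / complex_of_real (1 - t) = complex_of_real (real (n + 1) * t ^ n)"
      proof (intro allI impI)
        fix t assume "t \<in> {0<..<x}"
        then have "1 - t \<noteq> 0" using x by auto
        have "?f t / complex_of_real (1 - t) = complex_of_real (real (n + 1) * (t ^ n - t ^ (n + 1)) / (1 - t))"
          by (simp del: of_real_power add: of_real_diff of_real_mult of_real_divide)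
        also have "real (n + 1) * (t ^ n - t ^ (n + 1)) / (1 - t) = real (n + 1) * t ^ n"
          using \<open>1 - t \<noteq> 0\<close> by (simp add: field_simps)
        finally show "?f t / complex_of_real (1 - t) = complex_of_real (real (n + 1) * t ^ n)" .
      qed
    qed simp
    also have "\<dots> = integral {0<..<x} (\<lambda>t. complex_of_real (real (n + 1) * t ^ n))"
    proof (rule set_lebesgue_integral_eq_integral)
      have "set_integrable lborel {0..x} (\<lambda>t. complex_of_real (real (n + 1) * t ^ n))"
        by (intro borel_integrable_atLeastAtMost' continuous_intros)
      then have "set_integrable lebesgue {0..x} (\<lambda>t. complex_of_real (real (n + 1) * t ^ n))"
        unfolding set_integrable_def by (rule integrable_completion[THEN iffD2, rotated]) simp
      then show "set_integrable lebesgue {0<..<x} (\<lambda>t. complex_of_real (real (n + 1) * t ^ n))"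
        by (rule set_integrable_subset) auto
    qed
    also note int
    finally show ?thesis
      using x by (simp add: cesaro_fun_def)
  qed
  ultimately show ?thesis
    unfolding monomial_def
    using f by (simp add: cesaro.abs_eq L2_rel_def del: of_real_power)
      (intro abs_L2_eqI square_integrable_cesaro_fun square_integrable_power, auto)
qed

lemma cesaro_add: "cesaro (f + g) = cesaro f + cesaro g"
  and cesaro_scaleR: "cesaro (r *\<^sub>R f) = r *\<^sub>R cesaro f"
  and cesaro_scaleC: "cesaro (c *\<^sub>C f) = c *\<^sub>C cesaro f"
  and cesaro_0: "cesaro 0 = 0"
  and bounded_linear_cesaro: "bounded_linear cesaro"
  using bounded_clinear_cesaro unfolding bounded_clinear_def
  by (blast dest: bounded_linear.linear intro: linear_add linear_cmul linear_0)+

lemma cinner_scaleC_right: "cinner x (c *\<^sub>C y) = cnj c * cinner x y"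
  by (metis cinner_commute cinner_scaleC_left complex_cnj_mult complex_cnj_cnj)

lemma norm_scaleC: "norm (c *\<^sub>C x) = cmod c * norm x"
proof -
  have "inner (c *\<^sub>C x) (c *\<^sub>C x) = (cmod c)\<^sup>2 * inner x x"
  proof -
    have "cinner (c *\<^sub>C x) (c *\<^sub>C x) = (c * cnj c) * cinner x x"
      by (simp add: cinner_scaleC_left cinner_scaleC_right)
    also have "c * cnj c = complex_of_real ((cmod c)\<^sup>2)"
      by (rule complex_norm_square[symmetric])
    finally show ?thesis by (simp add: inner_eq_Re_cinner del: of_real_power)
  qed
  then show ?thesis
    by (simp add: norm_eq_sqrt_inner real_sqrt_mult)
qed

lemma monomial_tendsto_0: "monomial \<longlonglongrightarrow> 0"
proof -
  have "norm (monomial n) = sqrt (1 / real (n + n + 1))" for n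
    by (simp add: norm_eq_sqrt_inner inner_eq_Re_cinner cinner_monomial)
  moreover have "(\<lambda>n. sqrt (1 / real (n + n + 1))) \<longlonglongrightarrow> sqrt 0"
  proof (intro tendsto_real_sqrt)
    show "(\<lambda>n. 1 / real (n + n + 1)) \<longlonglongrightarrow> 0"
      by (rule tendsto_sandwich[OF _ _ tendsto_const LIMSEQ_inverse_real_of_nat])
        (auto simp: divide_simps)
  qed
  ultimately have "(\<lambda>n. norm (monomial n)) \<longlonglongrightarrow> 0" by simp
  then show ?thesis by (rule tendsto_norm_zero_cancel)
qed

text \<open>
  Although these functions all vanish at \<open>1\<close>, every monomial is a limit of their combinations:
  \<open>x\<^sup>n - x\<^sup>n\<^sup>+\<^sup>N\<close> is a telescoping sum of multiples of them, and \<open>x\<^sup>n\<^sup>+\<^sup>N\<close> tends to \<open>0\<close> in \<open>L\<^sup>2\<close>.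
\<close>

lemma cesaro_preimages_total:
  assumes K: "subspace K" "closed K" and mem: "\<And>c n. c *\<^sub>C cesaro_preimage n \<in> K"
  shows "K = UNIV"
proof (rule monomials_total[OF K])
  fix c n
  have step: "c *\<^sub>C (monomial m - monomial (m + 1)) \<in> K" for m
  proof -
    have "c *\<^sub>C (monomial m - monomial (m + 1)) =
        (c * complex_of_real (1 / real (m + 1))) *\<^sub>C cesaro_preimage m"
    proof -
      have "complex_of_real (1 / real (m + 1)) * complex_of_real (real (m + 1)) =
          complex_of_real (1 / real (m + 1) * real (m + 1))"
        by (rule of_real_mult[symmetric])
      also have "1 / real (m + 1) * real (m + 1) = 1" by simp
      finally have "complex_of_real (1 / real (m + 1)) * complex_of_real (real (m + 1)) = 1" by simp
      then show ?thesis
        by (simp only: cesaro_preimage_def scaleR_scaleC scaleC_scaleC mult.assoc mult_1_right)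
    qed
    then show ?thesis using mem by metis
  qed
  have diff: "c *\<^sub>C (monomial n - monomial (n + N)) \<in> K" for N
  proof (induction N)
    case 0
    then show ?case using subspace_0[OF K(1)] by simp
  next
    case (Suc N)
    have "c *\<^sub>C (monomial n - monomial (n + Suc N)) =
        c *\<^sub>C (monomial n - monomial (n + N)) + c *\<^sub>C (monomial (n + N) - monomial (n + N + 1))"
      by (simp flip: scaleC_add_right)
    then show ?case using subspace_add[OF K(1) Suc step] by simp
  qed
  have "(\<lambda>N. cmod c * norm (monomial (N + n))) \<longlonglongrightarrow> cmod c * norm (0::L2)"
    by (rule tendsto_mult_left[OF tendsto_norm[OF LIMSEQ_ignore_initial_segment[OF monomial_tendsto_0]]])
  then have "(\<lambda>N. c *\<^sub>C monomial (N + n)) \<longlonglongrightarrow> 0"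
    by (simp only: norm_scaleC[symmetric] norm_zero mult_zero_right tendsto_norm_zero_iff)
  then have "(\<lambda>N. c *\<^sub>C monomial n - c *\<^sub>C monomial (N + n)) \<longlonglongrightarrow> c *\<^sub>C monomial n - 0"
    by (intro tendsto_diff tendsto_const)
  then have "(\<lambda>N. c *\<^sub>C (monomial n - monomial (n + N))) \<longlonglongrightarrow> c *\<^sub>C monomial n"
    by (simp only: complex_vector.scale_right_diff_distrib add.commute[of n] diff_zero)
  then show "c *\<^sub>C monomial n \<in> K"
    by (rule closed_sequentially[OF K(2) diff])
qed

section \<open>Isometry of the identity minus the Cesaro operator\<close>

text \<open>
  Both sides are continuous and real bilinear, so complex multiples of the functions
  \<open>cesaro_preimage n\<close> suffice, first in one argument and then in the other. There the identity is
  \<open>1 / s = (n + 1) * (1 / s - 1 / (s + 1)) + (m + 1) * (1 / s - 1 / (s + 1))\<close> with \<open>s = m + n + 1\<close>.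
\<close>

lemma inner_cesaro:
  "inner (cesaro f) (cesaro g) = inner (cesaro f) g + inner f (cesaro g)"
proof -
  let ?D = "\<lambda>f g. inner (cesaro f) (cesaro g) - inner (cesaro f) g - inner f (cesaro g)"
  have cont: "continuous_on UNIV cesaro"
    by (rule linear_continuous_on[OF bounded_linear_cesaro])
  have base: "?D (c *\<^sub>C cesaro_preimage m) (d *\<^sub>C cesaro_preimage n) = 0" for c d m n
  proof -
    let ?e = cesaro_preimage
    have cm: "cinner x (y - z) = cinner x y - cinner x z" "cinner (y - z) x = cinner y x - cinner z x"
      "cinner x (r *\<^sub>R y) = r * cinner x y" "cinner (r *\<^sub>R y) x = r * cinner y x" for x y z :: L2 and r
    proof -
      show 1: "cinner (y - z) x = cinner y x - cinner z x" for x y z :: L2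
        by (metis add_diff_cancel_right' cinner_add_left diff_add_cancel)
      show "cinner x (y - z) = cinner x y - cinner x z"
        by (metis 1 cinner_commute complex_cnj_diff)
    qed (simp_all add: scaleR_scaleC cinner_scaleC_left cinner_scaleC_right)
    have "cinner (monomial m) (monomial n) = cinner (monomial m) (?e n) + cinner (?e m) (monomial n)"
    proof -
      define s where "s = real m + real n + 1"
      have s: "real (m + n + 1) = s" "real (m + (n + 1) + 1) = s + 1" "real (m + 1 + n + 1) = s + 1"
        "0 < s" "real (n + 1) + real (m + 1) = s + 1"
        by (simp_all add: s_def)
      have "1 / s = (real (n + 1) + real (m + 1)) * (1 / s - 1 / (s + 1))"
        unfolding s(5) using s(4) add_pos_pos[OF s(4) mult_pos_pos[OF s(4) s(4)]] by (simp add: field_simps)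
      then have "1 / s = real (n + 1) * (1 / s - 1 / (s + 1)) + real (m + 1) * (1 / s - 1 / (s + 1))"
        by (simp only: distrib_right)
      then show ?thesis
        unfolding cesaro_preimage_def cm cinner_monomial s(1-3)
          of_real_add[symmetric] of_real_mult[symmetric] of_real_diff[symmetric]
        by (rule arg_cong)
    qed
    then show ?thesis
      by (simp add: inner_eq_Re_cinner cesaro_scaleC cesaro_cesaro_preimage cinner_scaleC_left
          cinner_scaleC_right distrib_left right_diff_distrib)
  qed
  have left: "{f. ?D f (d *\<^sub>C cesaro_preimage n) = 0} = UNIV" for d n
  proof (rule cesaro_preimages_total)
    show "subspace {f. ?D f (d *\<^sub>C cesaro_preimage n) = 0}"
      unfolding subspace_def mem_Collect_eq cesaro_add cesaro_scaleR inner_add_left inner_add_right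
        inner_scaleR_left inner_scaleR_right
      by (auto simp: cesaro_0 algebra_simps)
    show "closed {f. ?D f (d *\<^sub>C cesaro_preimage n) = 0}"
      by (intro closed_Collect_eq continuous_intros cont)
  qed (use base in auto)
  have "{g. ?D f g = 0} = UNIV"
  proof (rule cesaro_preimages_total)
    show "subspace {g. ?D f g = 0}"
      unfolding subspace_def mem_Collect_eq cesaro_add cesaro_scaleR inner_add_left inner_add_right
        inner_scaleR_left inner_scaleR_right
      by (auto simp: cesaro_0 algebra_simps)
    show "closed {g. ?D f g = 0}"
      by (intro closed_Collect_eq continuous_intros cont)
  qed (use left in auto)
  then show ?thesis by (auto simp: set_eq_iff algebra_simps)
qed

text \<open>
  Expanding the square, \<open>\<parallel>f - C f\<parallel>\<^sup>2 = \<parallel>f\<parallel>\<^sup>2 - 2 \<langle>C f, f\<rangle> + \<parallel>C f\<parallel>\<^sup>2\<close>, and the last two terms cancel by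
  the previous identity with \<open>g = f\<close>.
\<close>

lemma norm_diff_cesaro: "norm (f - cesaro f) = norm f"
  using inner_cesaro[of f f]
  by (simp add: norm_eq_sqrt_inner inner_diff_left inner_diff_right inner_commute)

lemma cesaro_range_dense: "closure (range cesaro) = UNIV"
proof (rule monomials_total)
  show "subspace (closure (range cesaro))"
    using linear_subspace_image[OF bounded_linear.linear[OF bounded_linear_cesaro] subspace_UNIV]
    by (rule closure_subspace_real)
  show "c *\<^sub>C monomial n \<in> closure (range cesaro)" for c n
    using cesaro_scaleC[of c "cesaro_preimage n"] closure_subset
    by (metis cesaro_cesaro_preimage rangeI subsetD)
qed simp

section \<open>Cyclicity of the constant function\<close>

text \<open>
  Invariant closed subspaces can be divided by the Cesaro operator: the contraction principle applies
  to the isometry \<open>I - C\<close>, whose defect \<open>I - (I - C)\<close> is \<open>C\<close> itself.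
\<close>

lemma mem_if_cesaro_mem:
  assumes M: "subspace M" "closed M" "\<And>x. x \<in> M \<Longrightarrow> cesaro x \<in> M" and f: "cesaro f \<in> M"
  shows "f \<in> M"
proof (rule mem_closed_subspace_if_defect_mem[where U = "\<lambda>x. x - cesaro x"])
  show "linear (\<lambda>x. x - cesaro x)"
    by (intro linear_compose_sub linear_ident bounded_linear.linear bounded_linear_cesaro)
qed (use M f cesaro_range_dense in \<open>auto simp: norm_diff_cesaro intro: subspace_diff\<close>)

theorem proposition3p1:
  shows "cyclic_vector cesaro one_L2"
proof -
  define S where "S = complex_vector.span (range (\<lambda>n. (cesaro ^^ n) one_L2))"
  have S: "complex_vector.subspace S"
    unfolding S_def by (rule complex_vector.subspace_span)
  have "cesaro x \<in> S" if "x \<in> S" for x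
    using that unfolding S_def
  proof (induction rule: complex_vector.span_induct_alt)
    case base
    then show ?case
      using complex_vector.span_zero linear_0[OF bounded_linear.linear[OF bounded_linear_cesaro]] by simp
  next
    case (step c x y)
    then obtain n where n: "x = (cesaro ^^ n) one_L2" by blast
    then have "cesaro x \<in> range (\<lambda>n. (cesaro ^^ n) one_L2)"
      by (intro range_eqI[of _ _ "Suc n"]) simp
    then show ?case
      using step by (auto simp: cesaro_add cesaro_scaleC intro: complex_vector.span_add complex_vector.span_scale complex_vector.span_base)
  qed
  then have "cesaro ` closure S \<subseteq> closure S"
    using closure_bounded_linear_image_subset[OF bounded_linear_cesaro, of S] closure_mono[of "cesaro ` S" S]
    by blast
  then have inv: "x \<in> closure S \<Longrightarrow> cesaro x \<in> closure S" for x by blast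
  have sub: "subspace (closure S)"
    by (intro closure_subspace_real subspace_if_complex_subspace S)
  \<comment> \<open>In the step, \<open>c *\<^sub>C monomial n\<close> is the image under \<open>cesaro\<close> of \<open>c *\<^sub>C cesaro_preimage n\<close>, which
    therefore lies in \<open>closure S\<close> and carries the next monomial with it.\<close>
  have mem: "c *\<^sub>C monomial n \<in> closure S" for c n
  proof (induction n)
    case 0
    have "one_L2 = monomial 0"
      by (simp add: one_L2_def monomial_def)
    moreover have "one_L2 \<in> S"
      unfolding S_def by (rule complex_vector.span_base, rule range_eqI[of _ _ 0]) simp
    ultimately show ?case
      using complex_vector.subspace_scale[OF S] closure_subset by fastforce
  next
    case (Suc n)
    have "cesaro (c *\<^sub>C cesaro_preimage n) = c *\<^sub>C monomial n"
      by (simp add: cesaro_scaleC cesaro_cesaro_preimage)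
    then have "c *\<^sub>C cesaro_preimage n \<in> closure S"
      using Suc by (intro mem_if_cesaro_mem[OF sub closed_closure inv, of "c *\<^sub>C cesaro_preimage n"]) simp_all
    then have "c *\<^sub>C monomial n - (1 / real (n + 1)) *\<^sub>R c *\<^sub>C cesaro_preimage n \<in> closure S"
      by (intro subspace_diff subspace_scale sub Suc)
    also have "c *\<^sub>C monomial n - (1 / real (n + 1)) *\<^sub>R c *\<^sub>C cesaro_preimage n = c *\<^sub>C monomial (Suc n)"
    proof -
      have "(1 / real (n + 1)) *\<^sub>R c *\<^sub>C cesaro_preimage n = c *\<^sub>C (1 / real (n + 1)) *\<^sub>R cesaro_preimage n"
        by (simp add: scaleR_scaleC scaleC_scaleC mult.commute)
      also have "(1 / real (n + 1)) *\<^sub>R cesaro_preimage n = monomial n - monomial (Suc n)"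
        by (simp add: cesaro_preimage_def)
      finally show ?thesis by (simp flip: complex_vector.scale_right_diff_distrib)
    qed
    finally show ?case .
  qed
  have "closure S = UNIV"
    by (rule monomials_total[OF sub _ mem]) simp
  then show ?thesis
    unfolding cyclic_vector_def S_def using bounded_clinear_cesaro by blast
qed

end
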